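(* Let $(\Omega,\mathcal{F},\mathsf{P})$ be a complete probability space, let $\mathsf{H}$ be a separable real Hilbert space, let $\mathsf{A}\colon\mathsf{H}\to 2^{\mathsf{H}}$ be a maximally monotone operator such that $\operatorname{zer}\mathsf{A}\neq\varnothing$, let $(\gamma_n)_{n\in\mathbb{N}}$ be a sequence in $]0,+\infty[$ such that $\sum_{n\in\mathbb{N}}\gamma_n^2=+\infty$, let $(e_n)_{n\in\mathbb{N}}$ be a sequence in $L^2(\Omega,\mathcal{F},\mathsf{P};\mathsf{H})$, and let $x_0\in L^2(\Omega,\mathcal{F},\mathsf{P};\mathsf{H})$. Define recursively $$(\forall n\in\mathbb{N})\quad x_{n+1}=\mathsf{J}_{\gamma_n\mathsf{A}}x_n+e_n,$$ and, for every $n\in\mathbb{N}$, let $\mathcal{F}_n$ be the sub-$\sigma$-algebra of $\mathcal{F}$ generated by $(x_0,\ldots,x_n)$ and set $\theta_n=\sum_{k=0}^n\gamma_k^2$. Then the following hold: (i) Suppose that $\sum_{n\in\mathbb{N}}\sqrt{\mathsf{E}(\|e_n\|^2\mid\mathcal{F}_n)}<+\infty$ $\mathsf{P}$-a.s. and $\sum_{n\in\mathbb{N}}\gamma_{n+1}^{-2}\theta_n\mathsf{E}(\|e_n\|^2\mid\mathcal{F}_n)<+\infty$ $\mathsf{P}$-a.s. Then $\|{}^{\gamma_{n+1}}\mathsf{A}x_{n+1}\|=\mathrm{o}(1/\sqrt{\theta_n})$ $\mathsf{P}$-a.s. (ii) Suppose that $\sum_{n\in\mathbb{N}}\sqrt{\mathsf{E}\|e_n\|^2}<+\infty$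 and $\sum_{n\in\mathbb{N}}\gamma_{n+1}^{-2}\theta_n\mathsf{E}\|e_n\|^2<+\infty$. Then $\|{}^{\gamma_n}\mathsf{A}x_n\|=\mathrm{o}(1/\sqrt{\theta_n})$ $\mathsf{P}$-a.s. and $\mathsf{E}\|{}^{\gamma_n}\mathsf{A}x_n\|=\mathrm{o}(1/\sqrt{\theta_n})$.
   Context: $L^2(\Omega,\mathcal{F},\mathsf{P};\mathsf{H})$ is the space of (a.s. equivalence classes of) $\mathsf{H}$-valued random variables $x$ with $\mathsf{E}\|x\|^2<+\infty$. For a set-valued operator $\mathsf{A}\colon\mathsf{H}\to2^{\mathsf{H}}$, $\operatorname{zer}\mathsf{A}=\{\mathsf{x}\in\mathsf{H}\mid 0\in\mathsf{A}\mathsf{x}\}$ and the graph is $\operatorname{gra}\mathsf{A}=\{(\mathsf{x},\mathsf{x}^* )\mid\mathsf{x}^*\in\mathsf{A}\mathsf{x}\}$. $\mathsf{A}$ is monotone if $\langle\mathsf{x}-\mathsf{y}\mid\mathsf{x}^*-\mathsf{y}^*\rangle\geq0$ for all $(\mathsf{x},\mathsf{x}^* ),(\mathsf{y},\mathsf{y}^* )\in\operatorname{gra}\mathsf{A}$, and maximally monotone if, in addition, no monotone operator has a graph strictly containing $\operatorname{gra}\mathsf{A}$. The resolvent of $\mathsf{A}$ is $\mathsf{J}_{\mathsf{A}}=(\mathrm{Id}+\mathsf{A})^{-1}$; for $\mathsf{A}$ maximally monotone and $\gamma\in\,]0,+\infty[$, $\mathsf{J}_{\gamma\mathsf{A}}$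 is a single-valued operator defined on all of $\mathsf{H}$. The Yosida approximation of $\mathsf{A}$ of index $\gamma\in\,]0,+\infty[$ is ${}^{\gamma}\mathsf{A}=(\mathrm{Id}-\mathsf{J}_{\gamma\mathsf{A}})/\gamma$. For nonnegative sequences, $u_n=\mathrm{o}(1/v_n)$ means $u_nv_n\to0$ as $n\to+\infty$ ($\mathsf{P}$-a.s. when so indicated). *)

theory Defs
  imports "HOL-Probability.Probability"
begin

definition gra :: "('h \<Rightarrow> 'h set) \<Rightarrow> ('h \<times> 'h) set" where
  "gra A = {(x, u). u \<in> A x}"

definition zer :: "('h::zero \<Rightarrow> 'h set) \<Rightarrow> 'h set" where
  "zer A = {x. 0 \<in> A x}"

definition monotone_operator :: "('h::real_inner \<Rightarrow> 'h set) \<Rightarrow> bool" where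
  "monotone_operator A \<longleftrightarrow>
     (\<forall>(x, u) \<in> gra A. \<forall>(y, v) \<in> gra A. (x - y) \<bullet> (u - v) \<ge> 0)"

definition maximally_monotone :: "('h::real_inner \<Rightarrow> 'h set) \<Rightarrow> bool" where
  "maximally_monotone A \<longleftrightarrow>
     monotone_operator A \<and> \<not> (\<exists>B. monotone_operator B \<and> gra A \<subset> gra B)"

definition scale_operator :: "real \<Rightarrow> ('h::real_vector \<Rightarrow> 'h set) \<Rightarrow> 'h \<Rightarrow> 'h set" where
  "scale_operator \<gamma> A x = (\<lambda>u. \<gamma> *\<^sub>R u) ` A x"

definition inverse_operator :: "('h \<Rightarrow> 'h set) \<Rightarrow> 'h \<Rightarrow> 'h set" where
  "inverse_operator B y = {x. y \<in> B x}"

definition resolvent_set_valued :: "('h::plus \<Rightarrow> 'h set) \<Rightarrow> 'h \<Rightarrow> 'h set" where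
  "resolvent_set_valued A = inverse_operator (\<lambda>x. {x + u | u. u \<in> A x})"

text \<open>
  The point-valued resolvent. If \<open>A\<close> is maximally monotone and \<open>\<gamma> > 0\<close>, then on a Hilbert
  space \<open>resolvent_set_valued (scale_operator \<gamma> A) x\<close> is a singleton for every \<open>x\<close> (Minty),
  so that \<open>the_elem\<close> selects its unique element; otherwise the value is unspecified.
\<close>

definition resolvent :: "('h::plus \<Rightarrow> 'h set) \<Rightarrow> 'h \<Rightarrow> 'h" where
  "resolvent A x = the_elem (resolvent_set_valued A x)"

definition yosida :: "real \<Rightarrow> ('h::real_vector \<Rightarrow> 'h set) \<Rightarrow> 'h \<Rightarrow> 'h" where
  "yosida \<gamma> A x = (x - resolvent (scale_operator \<gamma> A) x) /\<^sub>R \<gamma>"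

text \<open>
  Elements of \<open>L\<^sup>2\<close> are handled through representatives; equalities between them are stated
  almost everywhere.
\<close>

definition L2_rv :: "'w measure \<Rightarrow> ('w \<Rightarrow> 'h::{real_normed_vector, second_countable_topology}) set" where
  "L2_rv M = {f \<in> borel_measurable M. integrable M (\<lambda>\<omega>. (norm (f \<omega>))\<^sup>2)}"

definition generated_sigma ::
    "'w measure \<Rightarrow> (nat \<Rightarrow> 'w \<Rightarrow> 'h::topological_space) \<Rightarrow> nat \<Rightarrow> 'w measure" where
  "generated_sigma M x n =
     sigma (space M) (\<Union>k\<le>n. {x k -` B \<inter> space M | B. B \<in> sets borel})"

end

theory Submission
  imports Defs
begin

text \<open>
  Write \<open>a\<^sub>n\<close> for the Yosida approximation at \<open>x\<^sub>n\<close> and \<open>p\<^sub>n\<close> for the resolvent. Monotonicity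
  gives two pointwise inequalities: \<open>\<parallel>p\<^sub>n - z\<parallel>\<^sup>2 + \<gamma>\<^sub>n\<^sup>2 \<parallel>a\<^sub>n\<parallel>\<^sup>2 \<le> \<parallel>x\<^sub>n - z\<parallel>\<^sup>2\<close> for a zero \<open>z\<close>, and
  \<open>\<parallel>a\<^sub>n\<^sub>+\<^sub>1\<parallel>\<^sup>2 \<le> \<parallel>a\<^sub>n\<parallel>\<^sup>2 + \<parallel>e\<^sub>n\<parallel>\<^sup>2 / \<gamma>\<^sub>n\<^sub>+\<^sub>1\<^sup>2\<close>. When the errors are summable, the first makes
  \<open>\<gamma>\<^sub>n\<^sup>2 \<parallel>a\<^sub>n\<parallel>\<^sup>2\<close> summable; then the second makes \<open>\<theta>\<^sub>n \<parallel>a\<^sub>n\<parallel>\<^sup>2\<close> converge, and its limit is 0 because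
  the series of \<open>\<gamma>\<^sub>n\<^sup>2 / \<theta>\<^sub>n\<close> diverges. This argument applies to each path, and also to \<open>L\<^sup>2\<close> norms.
  No supermartingale theorem is needed: by a truncation argument, a series of nonnegative
  variables converges almost surely as soon as the series of their conditional expectations
  along a filtration does, so the hypotheses of (i) already make the errors summable on almost
  every path.
\<close>

section \<open>Minty's theorem and resolvents\<close>

text \<open>
  The function \<open>t + \<parallel>z\<parallel>\<^sup>2 / 2\<close> is strongly convex in \<open>z\<close>, so minimizing sequences are Cauchy and no
  weak compactness is involved. The conclusion is the first-order optimality condition.
\<close>

lemma proximal_minimizer:
  fixes E :: "('z::{real_inner,banach} \<times> real) set"
  assumes "closed E" and "convex E" and "E \<noteq> {}"
    and bound: "\<And>z t. (z, t) \<in> E \<Longrightarrow> B \<le> t + (norm z)\<^sup>2 / 2"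
  shows "\<exists>z t. (z, t) \<in> E \<and> (\<forall>w s. (w, s) \<in> E \<longrightarrow> t + z \<bullet> z \<le> s + z \<bullet> w)"
proof -
  define \<phi> where "\<phi> = (\<lambda>p::'z \<times> real. snd p + (norm (fst p))\<^sup>2 / 2)"
  have bdd: "bdd_below (\<phi> ` E)"
    unfolding bdd_below_def \<phi>_def using bound by fastforce
  define m where "m = Inf (\<phi> ` E)"
  have m_le: "m \<le> \<phi> p" if "p \<in> E" for p
    unfolding m_def using bdd that by (auto intro: cInf_lower)
  have "\<exists>p\<in>E. \<phi> p < m + 1 / real (Suc n)" for n
  proof -
    have "Inf (\<phi> ` E) < m + 1 / real (Suc n)" by (simp add: m_def)
    from cInf_lessD[OF _ this] \<open>E \<noteq> {}\<close> show ?thesis by auto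
  qed
  then obtain p where pE: "\<And>n. p n \<in> E" and p_less: "\<And>n. \<phi> (p n) < m + 1 / real (Suc n)"
    by metis
  \<comment> \<open>By the parallelogram law, \<open>\<phi>\<close> at the midpoint is the average
    of the two values minus one eighth of the squared distance of the first components. Both values
    lie within \<open>1 / Suc n\<close> of the infimum, whence the factor 4 = 8 / 2.\<close>
  have strong: "(norm (fst (p i) - fst (p j)))\<^sup>2 \<le> 4 * (1 / real (Suc i) + 1 / real (Suc j))" for i j
  proof -
    have "(1/2) *\<^sub>R p i + (1/2) *\<^sub>R p j \<in> E"
      using convexD[OF \<open>convex E\<close> pE[of i] pE[of j], of "1/2" "1/2"] by simp
    from m_le[OF this] have "m \<le> (\<phi> (p i) + \<phi> (p j)) / 2 - (norm (fst (p i) - fst (p j)))\<^sup>2 / 8"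
      by (simp add: \<phi>_def power2_norm_eq_inner inner_simps inner_commute field_simps)
    moreover have "(\<phi> (p i) + \<phi> (p j)) / 2 \<le> m + (1 / real (Suc i) + 1 / real (Suc j)) / 2"
      using p_less[of i] p_less[of j] by argo
    ultimately show ?thesis by argo
  qed
  have "Cauchy (\<lambda>n. fst (p n))"
  proof (rule CauchyI)
    fix e :: real assume "0 < e"
    then obtain N where N: "8 / e\<^sup>2 < real N" using reals_Archimedean2 by blast
    have "norm (fst (p i) - fst (p j)) < e" if "N \<le> i" "N \<le> j" for i j
    proof -
      have "8 / e\<^sup>2 < real (Suc N)" using N by simp
      then have s: "8 * (1 / real (Suc N)) < e\<^sup>2" using \<open>0 < e\<close> by (simp add: field_simps)
      have "1 / real (Suc i) \<le> 1 / real (Suc N)" "1 / real (Suc j) \<le> 1 / real (Suc N)"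
        using that by (auto simp: frac_le)
      then have "(norm (fst (p i) - fst (p j)))\<^sup>2 < e\<^sup>2" using strong[of i j] s by argo
      then show ?thesis using \<open>0 < e\<close> by (meson less_imp_le power2_less_imp_less)
    qed
    then show "\<exists>M. \<forall>i\<ge>M. \<forall>j\<ge>M. norm (fst (p i) - fst (p j)) < e" by blast
  qed
  then obtain z where z: "(\<lambda>n. fst (p n)) \<longlonglongrightarrow> z"
    using Cauchy_convergent_iff convergent_def by blast
  have lim1: "(\<lambda>n. m + 1 / real (Suc n)) \<longlonglongrightarrow> m"
    using tendsto_add[OF tendsto_const[of m] LIMSEQ_inverse_real_of_nat] by (simp add: inverse_eq_divide)
  have \<phi>m: "(\<lambda>n. \<phi> (p n)) \<longlonglongrightarrow> m"
    by (rule tendsto_sandwich[OF _ _ tendsto_const[of m] lim1])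
      (simp_all add: m_le pE less_imp_le[OF p_less] del: of_nat_Suc)
  \<comment> \<open>Strong convexity controls only the first components. The heights converge
    because they are the values of \<open>\<phi>\<close> minus half the squared norms.\<close>
  define t where "t = m - (norm z)\<^sup>2 / 2"
  have "(\<lambda>n. \<phi> (p n) - (norm (fst (p n)))\<^sup>2 / 2) \<longlonglongrightarrow> t"
    unfolding t_def by (intro tendsto_intros \<phi>m z) auto
  then have "(\<lambda>n. snd (p n)) \<longlonglongrightarrow> t" by (simp add: \<phi>_def)
  from tendsto_Pair[OF z this] have "p \<longlonglongrightarrow> (z, t)" by simp
  then have ztE: "(z, t) \<in> E" using closed_sequentially[OF \<open>closed E\<close>] pE by blast
  have "t + z \<bullet> z \<le> s + z \<bullet> w" if ws: "(w, s) \<in> E" for w s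
  proof (rule ccontr)
    define c where "c = t + z \<bullet> z - (s + z \<bullet> w)"
    assume "\<not> ?thesis"
    then have "0 < c" by (simp add: c_def)
    \<comment> \<open>Moving a fraction \<open>r\<close> from the minimizer towards
      \<open>(w, s)\<close> would lower \<open>\<phi>\<close> by \<open>r * c\<close> up to a term
      of order r squared. Dividing by \<open>r\<close> and letting it tend to 0 contradicts
      \<open>0 < c\<close>.\<close>
    have *: "c \<le> r * ((norm (w - z))\<^sup>2 / 2)" if r: "0 < r" "r \<le> 1" for r
    proof -
      have "(1 - r) *\<^sub>R (z, t) + r *\<^sub>R (w, s) \<in> E"
        using convexD[OF \<open>convex E\<close> ztE ws, of "1 - r" r] r by simp
      from m_le[OF this]
      have "t + (norm z)\<^sup>2 / 2 \<le> (1 - r) * t + r * s + (norm ((1 - r) *\<^sub>R z + r *\<^sub>R w))\<^sup>2 / 2"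
        by (simp add: \<phi>_def t_def)
      also have "(norm ((1 - r) *\<^sub>R z + r *\<^sub>R w))\<^sup>2
          = (norm z)\<^sup>2 + 2 * r * (z \<bullet> w - z \<bullet> z) + r\<^sup>2 * (norm (w - z))\<^sup>2"
        by (simp only: power2_norm_eq_inner)
          (simp add: inner_simps inner_commute power2_eq_square algebra_simps)
      finally have "r * c \<le> r * (r * ((norm (w - z))\<^sup>2 / 2))"
        by (simp add: c_def field_simps power2_eq_square)
      then show ?thesis using r by simp
    qed
    have "((\<lambda>r. r * ((norm (w - z))\<^sup>2 / 2)) \<longlongrightarrow> 0 * ((norm (w - z))\<^sup>2 / 2)) (at_right 0)"
      by (intro tendsto_intros)
    moreover have "\<forall>\<^sub>F r in at_right 0. c \<le> r * ((norm (w - z))\<^sup>2 / 2)"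
      unfolding eventually_at_right_field using * by (intro exI[of _ 1]) auto
    ultimately have "c \<le> 0 * ((norm (w - z))\<^sup>2 / 2)"
      by (intro tendsto_lowerbound) auto
    then show False using \<open>0 < c\<close> by simp
  qed
  with ztE show ?thesis by blast
qed

text \<open>
  \<open>E\<close> below is the epigraph of the Fitzpatrick function of \<open>G\<close>, which dominates the duality
  product by maximality and agrees with it on \<open>G\<close>.
\<close>

lemma maximal_monotone_set_meets_antidiagonal:
  fixes G :: "('h::{real_inner,banach} \<times> 'h) set"
  assumes mono: "\<And>x u y v. (x, u) \<in> G \<Longrightarrow> (y, v) \<in> G \<Longrightarrow> 0 \<le> (x - y) \<bullet> (u - v)"
    and max: "\<And>x u. (\<And>y v. (y, v) \<in> G \<Longrightarrow> 0 \<le> (x - y) \<bullet> (u - v)) \<Longrightarrow> (x, u) \<in> G"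
  shows "\<exists>x. (x, - x) \<in> G"
proof -
  define E :: "(('h \<times> 'h) \<times> real) set" where
    "E = (\<Inter>(y, v)\<in>G. {q. fst (fst q) \<bullet> v + y \<bullet> snd (fst q) - y \<bullet> v \<le> snd q})"
  have E_iff: "((x, u), t) \<in> E \<longleftrightarrow> (\<forall>y v. (y, v) \<in> G \<longrightarrow> x \<bullet> v + y \<bullet> u - y \<bullet> v \<le> t)" for x u t
    by (auto simp: E_def)
  have "closed E"
    unfolding E_def split_def by (intro closed_INT ballI closed_Collect_le continuous_intros)
  have "convex E"
    unfolding E_def split_def
  proof (intro convex_INT convexI CollectI)
    fix a p q and r s :: real
    assume "p \<in> {q. fst (fst q) \<bullet> snd a + fst a \<bullet> snd (fst q) - fst a \<bullet> snd a \<le> snd q}"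
      and "q \<in> {q. fst (fst q) \<bullet> snd a + fst a \<bullet> snd (fst q) - fst a \<bullet> snd a \<le> snd q}"
      and rs: "0 \<le> r" "0 \<le> s" "r + s = 1"
    then have "r * (fst (fst p) \<bullet> snd a + fst a \<bullet> snd (fst p) - fst a \<bullet> snd a)
          + s * (fst (fst q) \<bullet> snd a + fst a \<bullet> snd (fst q) - fst a \<bullet> snd a) \<le> r * snd p + s * snd q"
      by (intro add_mono mult_left_mono) auto
    moreover have "r * (fst a \<bullet> snd a) + s * (fst a \<bullet> snd a) = fst a \<bullet> snd a"
      using rs by (metis distrib_right mult_1)
    ultimately show "fst (fst (r *\<^sub>R p + s *\<^sub>R q)) \<bullet> snd a + fst a \<bullet> snd (fst (r *\<^sub>R p + s *\<^sub>R q))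
        - fst a \<bullet> snd a \<le> snd (r *\<^sub>R p + s *\<^sub>R q)"
      by (simp add: inner_simps algebra_simps)
  qed
  have graph: "((x, u), x \<bullet> u) \<in> E" if "(x, u) \<in> G" for x u
    unfolding E_iff
  proof (intro allI impI)
    fix y v assume "(y, v) \<in> G"
    from mono[OF that this] show "x \<bullet> v + y \<bullet> u - y \<bullet> v \<le> x \<bullet> u"
      by (simp add: inner_simps)
  qed
  have "G \<noteq> {}" using max by auto
  then obtain y v where "(y, v) \<in> G" by auto
  then have "E \<noteq> {}" using graph by blast
  \<comment> \<open>If \<open>t < x \<bullet> u\<close>, membership in \<open>E\<close> makes
    \<open>(x, u)\<close> monotonically related to all of \<open>G\<close>. Maximality puts it in
    \<open>G\<close>, and its own constraint then bounds \<open>x \<bullet> u\<close> by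
    \<open>t\<close>.\<close>
  have dom: "x \<bullet> u \<le> t" if xE: "((x, u), t) \<in> E" for x u t
  proof (rule ccontr)
    assume less: "\<not> ?thesis"
    have "(x, u) \<in> G"
    proof (rule max)
      fix y v assume "(y, v) \<in> G"
      then have "x \<bullet> v + y \<bullet> u - y \<bullet> v \<le> t" using xE E_iff by blast
      then show "0 \<le> (x - y) \<bullet> (u - v)" using less by (simp add: inner_simps)
    qed
    then have "x \<bullet> u + x \<bullet> u - x \<bullet> u \<le> t" using xE E_iff by blast
    then show False using less by simp
  qed
  \<comment> \<open>The lower bound needed for minimization is 0: the duality product plus half the
    squared norm of the pair is half the squared norm of \<open>x + u\<close>.\<close>
  have sq: "0 \<le> (norm (x + u))\<^sup>2 / 2" for x u :: 'h by simp
  have "0 \<le> t + (norm z)\<^sup>2 / 2" if "(z, t) \<in> E" for z t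
    using dom[of "fst z" "snd z" t] that sq[of "fst z" "snd z"]
    by (simp add: power2_norm_eq_inner inner_simps inner_commute field_simps inner_prod_def)
  from proximal_minimizer[OF \<open>closed E\<close> \<open>convex E\<close> \<open>E \<noteq> {}\<close> this]
  obtain z t where z: "(z, t) \<in> E" "\<And>w s. (w, s) \<in> E \<Longrightarrow> t + z \<bullet> z \<le> s + z \<bullet> w"
    by blast
  obtain x u where "z = (x, u)" by fastforce
  with z have zE: "((x, u), t) \<in> E"
    and opt: "\<And>w s. (w, s) \<in> E \<Longrightarrow> t + (x, u) \<bullet> (x, u) \<le> s + (x, u) \<bullet> w"
    by blast+
  \<comment> \<open>Optimality is tested at the epigraph point above \<open>(y, v)\<close>. Adding
    \<open>x \<bullet> u \<le> t\<close> completes the square on the left and factors the right-hand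
    side.\<close>
  have key: "(norm (x + u))\<^sup>2 \<le> (- u - y) \<bullet> (- x - v)" if "(y, v) \<in> G" for y v
    using opt[OF graph[OF that]] dom[OF zE]
    by (simp add: power2_norm_eq_inner inner_simps inner_commute)
  have ux: "(- u, - x) \<in> G"
    by (rule max[OF order_trans[OF zero_le_power2 key]])
  \<comment> \<open>Testing \<open>key\<close> at \<open>(- u, - x)\<close> itself makes the
    right-hand side vanish.\<close>
  have "(norm (x + u))\<^sup>2 \<le> 0" using key[OF ux] by simp
  then have "u = - x" by (simp add: add_eq_0_iff)
  with ux show ?thesis by auto
qed

section \<open>Maximality as saturation, and existence of resolvents\<close>

lemma maximally_monotoneD:
  fixes A :: "'h::real_inner \<Rightarrow> 'h set"
  assumes "maximally_monotone A" "u \<in> A x" "v \<in> A y"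
  shows "0 \<le> (x - y) \<bullet> (u - v)"
  using assms by (auto simp: maximally_monotone_def monotone_operator_def gra_def)

text \<open>Otherwise adjoining the pair to the graph would give a strictly larger monotone
  operator.\<close>

lemma maximally_monotone_saturated:
  fixes A :: "'h::real_inner \<Rightarrow> 'h set"
  assumes A: "maximally_monotone A" and rel: "\<And>y v. v \<in> A y \<Longrightarrow> 0 \<le> (x - y) \<bullet> (u - v)"
  shows "u \<in> A x"
proof (rule ccontr)
  assume new: "u \<notin> A x"
  define B where "B = A(x := insert u (A x))"
  have graB: "gra B = insert (x, u) (gra A)" by (auto simp: B_def gra_def split: if_splits)
  have rel': "0 \<le> (y - x) \<bullet> (v - u)" if "v \<in> A y" for y v
    using rel[OF that] by (simp add: inner_simps)
  have "monotone_operator B"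
    unfolding monotone_operator_def graB
    using rel rel' maximally_monotoneD[OF A] by (auto simp: gra_def)
  moreover have "gra A \<subset> gra B" using new unfolding graB by (auto simp: gra_def)
  ultimately show False using A by (auto simp: maximally_monotone_def)
qed

lemma resolvent_set_valued_scale_iff:
  fixes A :: "'h::real_vector \<Rightarrow> 'h set"
  assumes "0 < c"
  shows "p \<in> resolvent_set_valued (scale_operator c A) x \<longleftrightarrow> (x - p) /\<^sub>R c \<in> A p"
proof
  assume "p \<in> resolvent_set_valued (scale_operator c A) x"
  then obtain u where "u \<in> A p" "x = p + c *\<^sub>R u"
    by (auto simp: resolvent_set_valued_def inverse_operator_def scale_operator_def)
  then show "(x - p) /\<^sub>R c \<in> A p" using assms by simp
next
  assume "(x - p) /\<^sub>R c \<in> A p"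
  moreover have "x = p + c *\<^sub>R ((x - p) /\<^sub>R c)" using assms by simp
  ultimately show "p \<in> resolvent_set_valued (scale_operator c A) x"
    unfolding resolvent_set_valued_def inverse_operator_def scale_operator_def by blast
qed

text \<open>Existence: the graph of \<open>c *\<^sub>R A\<close> shifted by \<open>- x\<close> is a
  maximal monotone set, and a point \<open>(p, - p)\<close> on it says that \<open>x\<close> lies in
  p + cAp. Uniqueness: monotonicity applied to two solutions bounds their squared distance by
  0.\<close>

lemma minty:
  fixes A :: "'h::{real_inner,banach} \<Rightarrow> 'h set"
  assumes A: "maximally_monotone A" and c: "0 < c"
  shows "\<exists>p. resolvent_set_valued (scale_operator c A) x = {p}"
proof -
  define G where "G = {(y, c *\<^sub>R v - x) | y v. v \<in> A y}"
  have "\<exists>p. (p, - p) \<in> G"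
  proof (rule maximal_monotone_set_meets_antidiagonal)
    fix y u z v assume "(y, u) \<in> G" "(z, v) \<in> G"
    then obtain u' v' where u': "u' \<in> A y" "u = c *\<^sub>R u' - x" and v': "v' \<in> A z" "v = c *\<^sub>R v' - x"
      by (auto simp: G_def)
    have "u - v = c *\<^sub>R (u' - v')" by (simp add: u' v' algebra_simps)
    then show "0 \<le> (y - z) \<bullet> (u - v)" using maximally_monotoneD[OF A u'(1) v'(1)] c by simp
  next
    fix y u assume rel: "\<And>z v. (z, v) \<in> G \<Longrightarrow> 0 \<le> (y - z) \<bullet> (u - v)"
    have "(u + x) /\<^sub>R c \<in> A y"
    proof (rule maximally_monotone_saturated[OF A])
      fix z v assume "v \<in> A z"
      then have "0 \<le> (y - z) \<bullet> (u - (c *\<^sub>R v - x))" by (intro rel) (auto simp: G_def)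
      also have "u - (c *\<^sub>R v - x) = c *\<^sub>R ((u + x) /\<^sub>R c - v)" using c by (simp add: algebra_simps)
      finally show "0 \<le> (y - z) \<bullet> ((u + x) /\<^sub>R c - v)" using c by (simp add: zero_le_mult_iff)
    qed
    moreover have "u = c *\<^sub>R ((u + x) /\<^sub>R c) - x" using c by simp
    ultimately show "(y, u) \<in> G" unfolding G_def by blast
  qed
  then obtain p v where v: "v \<in> A p" "- p = c *\<^sub>R v - x" by (auto simp: G_def)
  then have "(x - p) /\<^sub>R c = v" using c by (simp add: field_simps)
  with v have p: "p \<in> resolvent_set_valued (scale_operator c A) x"
    using resolvent_set_valued_scale_iff[OF c] by metis
  have "q = p" if "q \<in> resolvent_set_valued (scale_operator c A) x" for q
  proof -
    have "0 \<le> (q - p) \<bullet> ((x - q) /\<^sub>R c - (x - p) /\<^sub>R c)"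
      using that p by (intro maximally_monotoneD[OF A]) (simp_all add: resolvent_set_valued_scale_iff[OF c])
    also have "(x - q) /\<^sub>R c - (x - p) /\<^sub>R c = (- 1 / c) *\<^sub>R (q - p)" by (simp add: algebra_simps divide_inverse)
    finally have "0 \<le> - ((q - p) \<bullet> (q - p)) / c" by simp
    then have "(norm (q - p))\<^sup>2 \<le> 0" using c by (simp add: power2_norm_eq_inner divide_le_0_iff)
    then show "q = p" by simp
  qed
  with p show ?thesis by blast
qed

text \<open>Because the resolvent set is a singleton, \<open>the_elem\<close> returns its member.
  The estimates below use the resolvent through this inclusion.\<close>

lemma yosida_in:
  fixes A :: "'h::{real_inner,banach} \<Rightarrow> 'h set"
  assumes "maximally_monotone A" and "0 < c"
  shows "yosida c A x \<in> A (resolvent (scale_operator c A) x)"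
  using minty[OF assms, of x] resolvent_set_valued_scale_iff[OF \<open>0 < c\<close>, of _ A x]
  unfolding yosida_def resolvent_def by force

section \<open>Estimates for resolvents and Yosida approximations\<close>

lemma resolvent_plus_yosida:
  "0 < c \<Longrightarrow> resolvent (scale_operator c A) x + c *\<^sub>R yosida c A x = x"
  by (simp add: yosida_def)

text \<open>Monotonicity gives firm nonexpansiveness, and Cauchy-Schwarz does the rest. The
  resulting continuity serves to show that the iterates are measurable.\<close>

lemma resolvent_nonexpansive:
  fixes A :: "'h::{real_inner,banach} \<Rightarrow> 'h set"
  assumes A: "maximally_monotone A" and c: "0 < c"
  shows "norm (resolvent (scale_operator c A) x - resolvent (scale_operator c A) y) \<le> norm (x - y)"
proof -
  define p where "p = resolvent (scale_operator c A) x - resolvent (scale_operator c A) y"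
  have "0 \<le> p \<bullet> (yosida c A x - yosida c A y)"
    unfolding p_def by (intro maximally_monotoneD[OF A] yosida_in[OF A c])
  also have "yosida c A x - yosida c A y = ((x - y) - p) /\<^sub>R c"
    by (simp add: yosida_def p_def algebra_simps)
  finally have "p \<bullet> p \<le> p \<bullet> (x - y)" using c by (simp add: inner_simps field_simps)
  also have "\<dots> \<le> norm p * norm (x - y)" by (rule norm_cauchy_schwarz)
  finally have "norm p * norm p \<le> norm p * norm (x - y)" by (simp add: dot_square_norm power2_eq_square)
  then show ?thesis unfolding p_def[symmetric] by (cases "norm p = 0") (auto simp: mult_le_cancel_left)
qed

lemma continuous_on_resolvent:
  fixes A :: "'h::{real_inner,banach} \<Rightarrow> 'h set"
  assumes "maximally_monotone A" and "0 < c"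
  shows "continuous_on UNIV (resolvent (scale_operator c A))"
  unfolding continuous_on_iff dist_norm
  using resolvent_nonexpansive[OF assms] by (meson UNIV_I le_less_trans)

text \<open>Split \<open>x - z\<close> into \<open>(p - z) + c *\<^sub>R a\<close>. Monotonicity
  between the graph points \<open>(p, a)\<close> and \<open>(z, 0)\<close> makes the cross term
  nonnegative.\<close>

lemma resolvent_fejer:
  fixes A :: "'h::{real_inner,banach} \<Rightarrow> 'h set"
  assumes A: "maximally_monotone A" and c: "0 < c" and z: "z \<in> zer A"
  shows "(norm (resolvent (scale_operator c A) x - z))\<^sup>2 + c\<^sup>2 * (norm (yosida c A x))\<^sup>2
    \<le> (norm (x - z))\<^sup>2"
proof -
  define p a where "p = resolvent (scale_operator c A) x" and "a = yosida c A x"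
  have "0 \<le> (p - z) \<bullet> (a - 0)"
    using z unfolding p_def a_def zer_def by (intro maximally_monotoneD[OF A] yosida_in[OF A c]) auto
  then have "0 \<le> 2 * c * ((p - z) \<bullet> a)" using c by simp
  moreover have "x - z = (p - z) + c *\<^sub>R a"
    using resolvent_plus_yosida[OF c, of A x] by (simp add: p_def a_def algebra_simps)
  then have "(norm (x - z))\<^sup>2 = (norm (p - z))\<^sup>2 + 2 * c * ((p - z) \<bullet> a) + c\<^sup>2 * (norm a)\<^sup>2"
    by (simp only: power2_norm_eq_inner) (simp add: inner_simps inner_commute power2_eq_square algebra_simps)
  ultimately show ?thesis by (simp add: p_def a_def)
qed

text \<open>With \<open>a\<close>, \<open>b\<close> the old and new Yosida values, monotonicity
  between the two resolvent points says that \<open>e /\<^sub>R d - b\<close> and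
  \<open>b - a\<close> have nonnegative inner product. Adding twice this to the square of
  \<open>e /\<^sub>R d - (b - a)\<close> cancels all inner products. The old norm keeps coefficient
  exactly 1, as the later telescoping requires.\<close>

lemma norm_yosida_perturbed_step:
  fixes A :: "'h::{real_inner,banach} \<Rightarrow> 'h set"
  assumes A: "maximally_monotone A" and c: "0 < c" and d: "0 < d"
  shows "(norm (yosida d A (resolvent (scale_operator c A) x + e)))\<^sup>2
    \<le> (norm (yosida c A x))\<^sup>2 + (norm e)\<^sup>2 / d\<^sup>2"
proof -
  define p y where "p = resolvent (scale_operator c A) x" and "y = p + e"
  define q a b where "q = resolvent (scale_operator d A) y" and "a = yosida c A x" and "b = yosida d A y"
  have "0 \<le> (q - p) \<bullet> (b - a)"
    unfolding q_def p_def a_def b_def using yosida_in[OF A] c d by (intro maximally_monotoneD[OF A])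
  moreover have "q - p = d *\<^sub>R (e /\<^sub>R d - b)"
    using resolvent_plus_yosida[OF d, of A y] d by (simp add: q_def b_def y_def algebra_simps)
  ultimately have "0 \<le> (e /\<^sub>R d - b) \<bullet> (b - a)" using d by (simp add: zero_le_mult_iff)
  moreover have "0 \<le> (norm (e /\<^sub>R d - (b - a)))\<^sup>2" by simp
  ultimately have "(norm b)\<^sup>2 \<le> (norm a)\<^sup>2 + (norm (e /\<^sub>R d))\<^sup>2"
    by (simp only: power2_norm_eq_inner) (simp add: inner_simps inner_commute)
  then show ?thesis by (simp add: a_def b_def y_def p_def power_divide divide_simps)
qed

section \<open>Deterministic rate\<close>

text \<open>The unsquared steps first bound \<open>r\<close>. Squaring then costs only a constant
  times \<open>\<epsilon> n\<close>, and the decreases \<open>d\<close> telescope. The scalars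
  \<open>r\<close> and \<open>q\<close> can be distances on a single path or root mean
  squares.\<close>

lemma summable_decrease_of_perturbed_fejer:
  fixes r q d \<epsilon> :: "nat \<Rightarrow> real"
  assumes nonneg: "\<And>n. 0 \<le> r n" "\<And>n. 0 \<le> q n" "\<And>n. 0 \<le> d n" "\<And>n. 0 \<le> \<epsilon> n"
    and dec: "\<And>n. (q n)\<^sup>2 + d n \<le> (r n)\<^sup>2" and step: "\<And>n. r (Suc n) \<le> q n + \<epsilon> n"
    and sum: "summable \<epsilon>"
  shows "summable d"
proof -
  define S where "S = suminf \<epsilon>"
  have part: "(\<Sum>k<n. \<epsilon> k) \<le> S" for n
    unfolding S_def using sum nonneg by (intro sum_le_suminf) auto
  have "\<epsilon> n \<le> (\<Sum>k<Suc n. \<epsilon> k)" for n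
    using nonneg(4) by (simp add: sum_nonneg)
  then have \<epsilon>_le: "\<epsilon> n \<le> S" for n by (rule order_trans[OF _ part])
  have q_le: "q n \<le> r n" for n
  proof (rule power2_le_imp_le)
    show "(q n)\<^sup>2 \<le> (r n)\<^sup>2" using dec[of n] nonneg(3)[of n] by linarith
  qed (rule nonneg)
  have "r n \<le> r 0 + (\<Sum>k<n. \<epsilon> k)" for n
  proof (induction n)
    case (Suc n)
    then show ?case using step[of n] q_le[of n] by simp
  qed simp
  then have r_le: "r n \<le> r 0 + S" for n by (rule order_trans[OF _ add_left_mono[OF part]])
  \<comment> \<open>\<open>C\<close> bounds \<open>2 * q n + \<epsilon> n\<close>, since
    \<open>q n\<close> is at most \<open>r 0 + S\<close> and \<open>\<epsilon> n\<close> at most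
    \<open>S\<close>.\<close>
  define C where "C = 2 * (r 0 + S) + S"
  have "0 \<le> S" using part[of 0] by simp
  then have "0 \<le> C" using nonneg(1)[of 0] by (simp add: C_def)
  have inc: "(r (Suc n))\<^sup>2 + d n \<le> (r n)\<^sup>2 + C * \<epsilon> n" for n
  proof -
    have "(r (Suc n))\<^sup>2 \<le> (q n + \<epsilon> n)\<^sup>2"
      using step nonneg(1) by (intro power_mono)
    also have "\<dots> = (q n)\<^sup>2 + (2 * q n + \<epsilon> n) * \<epsilon> n" by (simp add: power2_eq_square algebra_simps)
    also have "(2 * q n + \<epsilon> n) * \<epsilon> n \<le> C * \<epsilon> n"
      using q_le[of n] r_le[of n] \<epsilon>_le[of n] nonneg(4)[of n] by (intro mult_right_mono) (auto simp: C_def)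
    finally show ?thesis using dec[of n] by simp
  qed
  have partial: "(\<Sum>k<n. d k) + (r n)\<^sup>2 \<le> (r 0)\<^sup>2 + C * (\<Sum>k<n. \<epsilon> k)" for n
  proof (induction n)
    case (Suc n)
    then show ?case using inc[of n] by (simp add: distrib_left)
  qed simp
  have "(\<Sum>k<n. d k) \<le> (r 0)\<^sup>2 + C * S" for n
    using partial[of n] mult_left_mono[OF part[of n] \<open>0 \<le> C\<close>] zero_le_power2[of "r n"] by linarith
  then show ?thesis by (rule summableI_nonneg_bounded[OF nonneg(3)])
qed

text \<open>The product \<open>\<theta> n * b n\<close> grows by at most
  \<open>\<theta> n * c n + g (Suc n) * b (Suc n)\<close>, which is summable, so it converges. A
  positive limit would make \<open>g n * b n\<close> at least a multiple of
  \<open>g n / \<theta> n\<close>, whose series diverges.\<close>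

lemma weighted_tendsto_zero:
  fixes g b c \<theta> :: "nat \<Rightarrow> real"
  assumes g: "\<And>n. 0 < g n" "\<not> summable g" and \<theta>: "\<And>n. \<theta> n = (\<Sum>k\<le>n. g k)"
    and b: "\<And>n. 0 \<le> b n" "\<And>n. b (Suc n) \<le> b n + c n" and c: "\<And>n. 0 \<le> c n"
    and sums: "summable (\<lambda>n. \<theta> n * c n)" "summable (\<lambda>n. g n * b n)"
  shows "(\<lambda>n. \<theta> n * b n) \<longlonglongrightarrow> 0"
proof -
  have \<theta>_pos: "0 < \<theta> n" for n unfolding \<theta> using g(1) by (intro sum_pos) auto
  have \<theta>_Suc: "\<theta> (Suc n) = \<theta> n + g (Suc n)" for n by (simp add: \<theta>)
  have \<theta>_mono: "\<theta> m \<le> \<theta> n" if "m \<le> n" for m n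
    unfolding \<theta> using that g(1) by (intro sum_mono2) (auto intro: less_imp_le)
  define w where "w = (\<lambda>n. \<theta> n * b n)"
  have w_nonneg: "0 \<le> w n" for n unfolding w_def using \<theta>_pos[of n] b(1)[of n] by simp
  define \<eta> where "\<eta> = (\<lambda>n. \<theta> n * c n + g (Suc n) * b (Suc n))"
  have \<eta>_nonneg: "0 \<le> \<eta> n" for n
    unfolding \<eta>_def using \<theta>_pos[of n] c[of n] g(1)[of "Suc n"] b(1)[of "Suc n"] by simp
  have \<eta>_sum: "summable \<eta>"
    unfolding \<eta>_def using sums summable_Suc_iff[of "\<lambda>n. g n * b n"] by (intro summable_add) auto
  have w_step: "w (Suc n) \<le> w n + \<eta> n" for n
  proof -
    have "\<theta> n * b (Suc n) \<le> \<theta> n * (b n + c n)"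
      using b(2) \<theta>_pos[of n] by (intro mult_left_mono) auto
    then show ?thesis by (simp add: w_def \<eta>_def \<theta>_Suc algebra_simps)
  qed
  \<comment> \<open>Subtracting the accumulated increments leaves a decreasing sequence that is
    bounded below.\<close>
  define v where "v = (\<lambda>n. w n - (\<Sum>k<n. \<eta> k))"
  have "decseq v"
    using w_step by (intro decseq_SucI) (simp add: v_def algebra_simps)
  moreover have "- suminf \<eta> \<le> v n" for n
  proof -
    have "(\<Sum>k<n. \<eta> k) \<le> suminf \<eta>" using \<eta>_sum \<eta>_nonneg by (intro sum_le_suminf) auto
    then show ?thesis using w_nonneg[of n] by (simp add: v_def)
  qed
  ultimately obtain l where "v \<longlonglongrightarrow> l" using decseq_convergent by blast
  from tendsto_add[OF this summable_LIMSEQ[OF \<eta>_sum]]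
  obtain L where L: "w \<longlonglongrightarrow> L" by (auto simp: v_def)
  have "0 \<le> L" using LIMSEQ_le_const[OF L] w_nonneg by blast
  moreover have False if "0 < L"
    \<comment> \<open>As in the Abel--Dini theorem, \<open>g / \<theta>\<close> fails the Cauchy criterion.\<close>
  proof -
    have "\<forall>\<^sub>F n in sequentially. L / 2 < w n"
      using L that by (intro order_tendstoD) auto
    then obtain N1 where N1: "\<And>n. N1 \<le> n \<Longrightarrow> L / 2 < w n"
      unfolding eventually_sequentially by blast
    have "\<exists>N. \<forall>m\<ge>N. \<forall>n. norm (\<Sum>k=m..<n. g k * b k) < L / 4"
      using sums(2)[unfolded summable_Cauchy, rule_format, of "L / 4"] that by simp
    then obtain N2 where N2: "\<And>m n. N2 \<le> m \<Longrightarrow> norm (\<Sum>k=m..<n. g k * b k) < L / 4"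
      by blast
    define N where "N = max N1 N2"
    then have N: "N1 \<le> N" "N2 \<le> N" by simp_all
    \<comment> \<open>Once \<open>\<theta>\<close> has more than doubled, the block after
      \<open>N\<close> carries over half of \<open>\<theta> n\<close>. Each \<open>b k\<close> in it
      is at least \<open>L / (2 * \<theta> n)\<close>, so the block sum is at least
      \<open>L / 4\<close>, against the Cauchy bound.\<close>
    have "\<exists>n. 2 * \<theta> N < \<theta> n"
    proof (rule ccontr)
      assume "\<not> ?thesis"
      then have "(\<Sum>k\<le>n. g k) \<le> 2 * \<theta> N" for n by (simp add: \<theta>[symmetric] not_less)
      then have "summable g" using g(1) by (intro bounded_imp_summable) (auto intro: less_imp_le)
      then show False using g(2) by contradiction
    qed
    then obtain n where n: "2 * \<theta> N < \<theta> n" by blast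
    then have "N \<le> n" using \<theta>_mono[of n N] \<theta>_pos[of N] by (cases "N \<le> n") auto
    have tele: "(\<Sum>k=Suc N..<Suc n. g k) = \<theta> n - \<theta> N"
    proof -
      have "{..n} = {..N} \<union> {Suc N..<Suc n}" using \<open>N \<le> n\<close> by auto
      then have "\<theta> n = \<theta> N + (\<Sum>k=Suc N..<Suc n. g k)"
        unfolding \<theta> by (simp only:) (intro sum.union_disjoint, auto)
      then show ?thesis by simp
    qed
    have "L / 4 \<le> L / (2 * \<theta> n) * (\<theta> n - \<theta> N)"
      using n \<theta>_pos[of n] that by (simp add: field_simps)
    also have "\<dots> = (\<Sum>k=Suc N..<Suc n. g k * (L / (2 * \<theta> n)))"
      unfolding tele[symmetric] by (simp only: mult.commute[of "L / (2 * \<theta> n)"] sum_distrib_right)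
    also have "\<dots> \<le> (\<Sum>k=Suc N..<Suc n. g k * b k)"
    proof (intro sum_mono mult_left_mono)
      fix k assume k: "k \<in> {Suc N..<Suc n}"
      then have "N1 \<le> k" using N by simp
      then have "L / 2 < \<theta> k * b k" using N1[of k] by (simp add: w_def)
      also have "\<dots> \<le> \<theta> n * b k" using k b(1) \<theta>_mono by (intro mult_right_mono) auto
      finally show "L / (2 * \<theta> n) \<le> b k" using \<theta>_pos[of n] by (simp add: field_simps)
      show "0 \<le> g k" using g(1) less_imp_le by blast
    qed
    also have "\<dots> < L / 4" using N2[of "Suc N" "Suc n"] N by simp
    finally show False by simp
  qed
  ultimately have "L = 0" by fastforce
  with L show ?thesis by (simp add: w_def)
qed

text \<open>The Fejer estimate makes the weighted squares of the Yosida norms summable; the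
  perturbed step then feeds \<open>weighted_tendsto_zero\<close> with these squares, and a square
  root gives the rate.\<close>

theorem proximal_point_rate:
  fixes A :: "'h::{real_inner,banach} \<Rightarrow> 'h set"
  assumes A: "maximally_monotone A" and z: "z \<in> zer A"
    and \<gamma>: "\<And>n. 0 < \<gamma> n" "\<not> summable (\<lambda>n. (\<gamma> n)\<^sup>2)" and \<theta>: "\<And>n. \<theta> n = (\<Sum>k\<le>n. (\<gamma> k)\<^sup>2)"
    and x: "\<And>n. x (Suc n) = resolvent (scale_operator (\<gamma> n) A) (x n) + e n"
    and e: "summable (\<lambda>n. norm (e n))" "summable (\<lambda>n. \<theta> n / (\<gamma> (Suc n))\<^sup>2 * (norm (e n))\<^sup>2)"
  shows "(\<lambda>n. norm (yosida (\<gamma> n) A (x n)) * sqrt (\<theta> n)) \<longlonglongrightarrow> 0"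
proof -
  define p where "p = (\<lambda>n. resolvent (scale_operator (\<gamma> n) A) (x n))"
  define a where "a = (\<lambda>n. yosida (\<gamma> n) A (x n))"
  have x': "x (Suc n) = p n + e n" for n by (simp add: x p_def)
  have "norm (x (Suc n) - z) \<le> norm (p n - z) + norm (e n)" for n
    using norm_triangle_ineq[of "p n - z" "e n"] by (simp add: x' algebra_simps)
  then have sum: "summable (\<lambda>n. (\<gamma> n)\<^sup>2 * (norm (a n))\<^sup>2)"
    by (intro summable_decrease_of_perturbed_fejer[where r = "\<lambda>n. norm (x n - z)"
          and q = "\<lambda>n. norm (p n - z)" and \<epsilon> = "\<lambda>n. norm (e n)", OF _ _ _ _ _ _ e(1)])
      (auto simp: p_def a_def resolvent_fejer[OF A \<gamma>(1) z])
  have "(\<lambda>n. \<theta> n * (norm (a n))\<^sup>2) \<longlonglongrightarrow> 0"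
  proof (rule weighted_tendsto_zero[OF _ \<gamma>(2) \<theta>])
    show "(norm (a (Suc n)))\<^sup>2 \<le> (norm (a n))\<^sup>2 + (norm (e n))\<^sup>2 / (\<gamma> (Suc n))\<^sup>2" for n
      unfolding a_def x by (rule norm_yosida_perturbed_step[OF A \<gamma>(1) \<gamma>(1)])
  qed (use e(2) sum in \<open>simp_all add: \<gamma>(1) less_imp_neq[OF \<gamma>(1), symmetric]\<close>)
  from tendsto_real_sqrt[OF this]
  show ?thesis by (simp add: a_def real_sqrt_mult mult.commute)
qed

section \<open>Almost sure summability and \<open>L\<^sup>2\<close> norms\<close>

text \<open>The preimages under \<open>f\<close> and \<open>g\<close> differ by a null set, which
  completeness makes measurable. This matters because the recursion holds only almost everywhere and
  measurability is assumed for \<open>x 0\<close> alone among the iterates.\<close>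

lemma (in complete_measure) measurable_AE_cong:
  assumes f: "f \<in> measurable M N" and eq: "AE \<omega> in M. g \<omega> = f \<omega>"
    and g: "\<And>\<omega>. \<omega> \<in> space M \<Longrightarrow> g \<omega> \<in> space N"
  shows "g \<in> measurable M N"
proof (rule measurableI)
  fix B assume "B \<in> sets N"
  then have "f -` B \<inter> space M \<in> sets M" using f by (rule measurable_sets[rotated])
  then show "g -` B \<inter> space M \<in> sets M"
  proof (rule in_sets_AE[rotated])
    show "AE \<omega> in M. (\<omega> \<in> f -` B \<inter> space M) = (\<omega> \<in> g -` B \<inter> space M)"
      using eq by eventually_elim auto
  qed auto
qed (rule g)

text \<open>Termwise integration of a nonnegative series shows that its sum has finite integral,
  hence is finite almost everywhere.\<close>

lemma AE_summable_of_summable_integral: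
  fixes f :: "nat \<Rightarrow> 'a \<Rightarrow> real"
  assumes f: "\<And>n. integrable M (f n)" "\<And>n \<omega>. 0 \<le> f n \<omega>"
    and sum: "summable (\<lambda>n. \<integral>\<omega>. f n \<omega> \<partial>M)"
  shows "AE \<omega> in M. summable (\<lambda>n. f n \<omega>)"
proof -
  have [measurable]: "f n \<in> borel_measurable M" for n using f(1) by auto
  have "(\<integral>\<^sup>+\<omega>. (\<Sum>n. ennreal (f n \<omega>)) \<partial>M) = (\<Sum>n. \<integral>\<^sup>+\<omega>. ennreal (f n \<omega>) \<partial>M)"
    by (rule nn_integral_suminf) simp
  also have "\<dots> = (\<Sum>n. ennreal (\<integral>\<omega>. f n \<omega> \<partial>M))"
    using f by (intro suminf_cong nn_integral_eq_integral) auto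
  also have "\<dots> = ennreal (\<Sum>n. \<integral>\<omega>. f n \<omega> \<partial>M)"
    by (rule suminf_ennreal2[OF _ sum]) (simp add: f(2))
  finally have "(\<integral>\<^sup>+\<omega>. (\<Sum>n. ennreal (f n \<omega>)) \<partial>M) \<noteq> \<infinity>" by (simp only:) simp
  then have "AE \<omega> in M. (\<Sum>n. ennreal (f n \<omega>)) \<noteq> \<infinity>"
    by (rule nn_integral_PInf_AE[rotated]) measurable
  then show ?thesis
  proof eventually_elim
    case (elim \<omega>)
    then show ?case using f(2) by (intro summable_suminf_not_top) (auto simp only: infinity_ennreal_def)
  qed
qed

text \<open>If the last term is kept, all terms together stay below \<open>K\<close>; if it is
  dropped, the induction hypothesis applies.\<close>

lemma sum_stopped_le:
  fixes c :: "nat \<Rightarrow> real"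
  assumes "\<And>n. 0 \<le> c n" and "0 \<le> K"
  shows "(\<Sum>n<N. if (\<Sum>k\<le>n. c k) \<le> K then c n else 0) \<le> K"
proof (induction N)
  case (Suc N)
  show ?case
  proof (cases "(\<Sum>k\<le>N. c k) \<le> K")
    case True
    have "(\<Sum>n<Suc N. if (\<Sum>k\<le>n. c k) \<le> K then c n else 0) \<le> (\<Sum>n<Suc N. c n)"
      using assms(1) by (intro sum_mono) auto
    then show ?thesis using True by (simp add: lessThan_Suc_atMost)
  qed (use Suc in simp)
qed (use assms in simp)

text \<open>A conditional Borel-Cantelli statement for nonnegative variables. It turns the
  hypotheses of (i) into summability of the errors themselves.\<close>

lemma (in prob_space) AE_summable_of_summable_cond_exp:
  fixes X :: "nat \<Rightarrow> 'a \<Rightarrow> real"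
  assumes sub: "\<And>n. subalgebra M (F n)" and nested: "\<And>m n. m \<le> n \<Longrightarrow> subalgebra (F n) (F m)"
    and X: "\<And>n. integrable M (X n)" "\<And>n \<omega>. 0 \<le> X n \<omega>"
    and sum: "AE \<omega> in M. summable (\<lambda>n. real_cond_exp M (F n) (X n) \<omega>)"
  shows "AE \<omega> in M. summable (\<lambda>n. X n \<omega>)"
proof -
  interpret F: sigma_finite_subalgebra M "F n" for n
    using sub by (intro finite_measure_subalgebra_is_sigma_finite)
      (simp add: finite_measure_subalgebra_def finite_measure_subalgebra_axioms_def finite_measure_axioms)
  have [measurable]: "X n \<in> borel_measurable M" for n using X(1) by auto
  define C where "C = (\<lambda>n. real_cond_exp M (F n) (X n))"
  have C_pos: "AE \<omega> in M. \<forall>n. 0 \<le> C n \<omega>"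
    unfolding AE_all_countable C_def using X(2) by (intro allI F.real_cond_exp_pos) auto
  have C_meas: "C k \<in> borel_measurable (F n)" if "k \<le> n" for k n
    unfolding C_def by (rule measurable_from_subalg[OF nested[OF that]]) simp
  \<comment> \<open>Stopping the series when the compensator exceeds \<open>K\<close> is \<open>F n\<close>-measurable, bounds the
    expectation by \<open>K\<close>, and changes nothing on the event that the compensator stays below \<open>K\<close>.\<close>
  define D where "D = (\<lambda>(K::nat) n \<omega>. if (\<Sum>k\<le>n. C k \<omega>) \<le> real K then 1 else (0::real))"
  have D_meas: "D K n \<in> borel_measurable (F n)" for K n
  proof -
    have [measurable]: "(\<lambda>\<omega>. \<Sum>k\<le>n. C k \<omega>) \<in> borel_measurable (F n)"
      using C_meas by (intro borel_measurable_sum) auto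
    show ?thesis unfolding D_def by measurable
  qed
  have [measurable]: "D K n \<in> borel_measurable M" for K n
    using measurable_from_subalg[OF sub D_meas] .
  have DX: "integrable M (\<lambda>\<omega>. D K n \<omega> * X n \<omega>)" for K n
  proof (rule Bochner_Integration.integrable_bound[OF X(1)[of n]])
    show "AE \<omega> in M. norm (D K n \<omega> * X n \<omega>) \<le> norm (X n \<omega>)" by (simp add: D_def)
  qed measurable
  \<comment> \<open>The factor \<open>D K n\<close> is \<open>F n\<close>-measurable, so under the
    integral \<open>X n\<close> may be replaced by its conditional expectation.\<close>
  have DC: "integrable M (\<lambda>\<omega>. D K n \<omega> * C n \<omega>)"
    "(\<integral>\<omega>. D K n \<omega> * C n \<omega> \<partial>M) = (\<integral>\<omega>. D K n \<omega> * X n \<omega> \<partial>M)" for K n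
    unfolding C_def using F.real_cond_exp_intg[OF DX D_meas] by simp_all
  have "summable (\<lambda>n. \<integral>\<omega>. D K n \<omega> * X n \<omega> \<partial>M)" for K
  proof (rule summableI_nonneg_bounded)
    show "0 \<le> (\<integral>\<omega>. D K n \<omega> * X n \<omega> \<partial>M)" for n
      by (rule Bochner_Integration.integral_nonneg) (simp add: D_def X(2))
    fix N
    have "(\<Sum>n<N. \<integral>\<omega>. D K n \<omega> * X n \<omega> \<partial>M) = (\<integral>\<omega>. (\<Sum>n<N. D K n \<omega> * C n \<omega>) \<partial>M)"
      using DC by simp
    also have "\<dots> \<le> (\<integral>\<omega>. real K \<partial>M)"
    proof (rule integral_mono_AE)
      show "AE \<omega> in M. (\<Sum>n<N. D K n \<omega> * C n \<omega>) \<le> real K"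
        using C_pos
      proof eventually_elim
        case (elim \<omega>)
        have "(\<Sum>n<N. D K n \<omega> * C n \<omega>)
            = (\<Sum>n<N. if (\<Sum>k\<le>n. C k \<omega>) \<le> real K then C n \<omega> else 0)"
          by (intro sum.cong) (auto simp: D_def)
        also have "\<dots> \<le> real K" using elim by (intro sum_stopped_le) auto
        finally show ?case .
      qed
    qed (use DC in auto)
    also have "\<dots> = real K" by (simp add: prob_space)
    finally show "(\<Sum>n<N. \<integral>\<omega>. D K n \<omega> * X n \<omega> \<partial>M) \<le> real K" .
  qed
  \<comment> \<open>The bound on the compensator depends on the path. Restricting \<open>K\<close>
    to naturals allows one null set for all levels.\<close>
  then have "AE \<omega> in M. \<forall>K. summable (\<lambda>n. D K n \<omega> * X n \<omega>)"
    unfolding AE_all_countable using DX X(2)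
    by (intro allI AE_summable_of_summable_integral) (auto simp: D_def)
  then show ?thesis using C_pos sum
  proof eventually_elim
    case (elim \<omega>)
    then have C: "\<And>n. 0 \<le> C n \<omega>" "summable (\<lambda>n. C n \<omega>)" by (auto simp: C_def)
    obtain K where K: "(\<Sum>n. C n \<omega>) \<le> real K" using real_arch_simple by blast
    have "(\<Sum>k\<le>n. C k \<omega>) \<le> real K" for n
      by (rule order_trans[OF sum_le_suminf K]) (simp_all add: C)
    then have "(\<lambda>n. D K n \<omega> * X n \<omega>) = (\<lambda>n. X n \<omega>)" by (simp add: D_def)
    with elim(1) show ?case by metis
  qed
qed

lemma square_sum_le:
  fixes a b t :: real
  assumes "0 < t"
  shows "(a + b)\<^sup>2 \<le> (1 + t) * a\<^sup>2 + (1 + 1 / t) * b\<^sup>2"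
proof -
  have "0 \<le> (t * a - b)\<^sup>2 / t" using assms by simp
  also have "\<dots> = t * a\<^sup>2 + b\<^sup>2 / t - 2 * a * b"
    using assms by (simp add: power2_eq_square field_simps)
  finally show ?thesis by (simp add: power2_eq_square algebra_simps)
qed

lemma integrable_square_add:
  fixes f g :: "'a \<Rightarrow> real"
  assumes [measurable]: "f \<in> borel_measurable M" "g \<in> borel_measurable M"
    and "integrable M (\<lambda>x. (f x)\<^sup>2)" "integrable M (\<lambda>x. (g x)\<^sup>2)"
  shows "integrable M (\<lambda>x. (f x + g x)\<^sup>2)"
proof (rule Bochner_Integration.integrable_bound)
  show "integrable M (\<lambda>x. 2 * (f x)\<^sup>2 + 2 * (g x)\<^sup>2)" using assms by simp
  show "AE x in M. norm ((f x + g x)\<^sup>2) \<le> norm (2 * (f x)\<^sup>2 + 2 * (g x)\<^sup>2)"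
    using square_sum_le[of 1 "f x" "g x" for x] by simp
qed measurable

text \<open>Minkowski's inequality for exponent 2: integrate \<open>square_sum_le\<close> with
  \<open>t\<close> equal to the ratio of the two norms, where the bound becomes a perfect
  square.\<close>

lemma sqrt_integral_square_triangle:
  fixes f g :: "'a \<Rightarrow> real"
  assumes [measurable]: "f \<in> borel_measurable M" "g \<in> borel_measurable M"
    and int: "integrable M (\<lambda>x. (f x)\<^sup>2)" "integrable M (\<lambda>x. (g x)\<^sup>2)"
  shows "sqrt (\<integral>x. (f x + g x)\<^sup>2 \<partial>M) \<le> sqrt (\<integral>x. (f x)\<^sup>2 \<partial>M) + sqrt (\<integral>x. (g x)\<^sup>2 \<partial>M)"
proof (rule field_le_epsilon)
  define a b where "a = sqrt (\<integral>x. (f x)\<^sup>2 \<partial>M)" and "b = sqrt (\<integral>x. (g x)\<^sup>2 \<partial>M)"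
  have ab: "0 \<le> a" "0 \<le> b" "a\<^sup>2 = (\<integral>x. (f x)\<^sup>2 \<partial>M)" "b\<^sup>2 = (\<integral>x. (g x)\<^sup>2 \<partial>M)"
    by (simp_all add: a_def b_def)
  fix \<epsilon> :: real assume "0 < \<epsilon>"
  \<comment> \<open>Enlarging both norms by \<open>\<epsilon> / 2\<close> keeps the ratio defined
    and positive even when a norm vanishes.\<close>
  define a' b' where "a' = a + \<epsilon> / 2" and "b' = b + \<epsilon> / 2"
  have ab': "0 < a'" "0 < b'" "a \<le> a'" "b \<le> b'" using ab \<open>0 < \<epsilon>\<close> by (auto simp: a'_def b'_def)
  have "(\<integral>x. (f x + g x)\<^sup>2 \<partial>M) \<le> (\<integral>x. (1 + b' / a') * (f x)\<^sup>2 + (1 + 1 / (b' / a')) * (g x)\<^sup>2 \<partial>M)"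
    using int ab' by (intro integral_mono integrable_square_add square_sum_le) auto
  also have "\<dots> = (1 + b' / a') * a\<^sup>2 + (1 + 1 / (b' / a')) * b\<^sup>2"
    using int by (simp add: ab)
  also have "\<dots> \<le> (1 + b' / a') * a'\<^sup>2 + (1 + 1 / (b' / a')) * b'\<^sup>2"
    using ab ab' by (intro add_mono mult_left_mono power_mono) auto
  also have "\<dots> = (a' + b')\<^sup>2"
    using ab' by (simp add: power2_eq_square field_simps)
  finally have "sqrt (\<integral>x. (f x + g x)\<^sup>2 \<partial>M) \<le> a' + b'"
    using ab' by (simp add: real_le_lsqrt)
  then show "sqrt (\<integral>x. (f x + g x)\<^sup>2 \<partial>M) \<le> a + b + \<epsilon>" by (simp add: a'_def b'_def)
qed

text \<open>This is nonnegativity of the variance.\<close>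

lemma (in prob_space) integral_le_sqrt_integral_square:
  fixes f :: "'a \<Rightarrow> real"
  assumes [measurable]: "f \<in> borel_measurable M" and "integrable M (\<lambda>x. (f x)\<^sup>2)"
  shows "(\<integral>x. f x \<partial>M) \<le> sqrt (\<integral>x. (f x)\<^sup>2 \<partial>M)"
proof -
  have "integrable M f" using assms by (rule square_integrable_imp_integrable)
  from variance_eq[OF this assms(2)] variance_positive[of f] show ?thesis
    by (intro real_le_rsqrt) simp
qed

section \<open>The stochastic proximal point algorithm\<close>

lemma space_generated_sigma [simp]: "space (generated_sigma M x n) = space M"
  by (auto simp: generated_sigma_def space_measure_of_conv)

lemma sets_generated_sigma:
  "sets (generated_sigma M x n)
    = sigma_sets (space M) (\<Union>k\<le>n. {x k -` B \<inter> space M | B. B \<in> sets borel})"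
  unfolding generated_sigma_def by (rule sets_measure_of) auto

lemma subalgebra_generated_sigma:
  assumes "\<And>k. x k \<in> borel_measurable M"
  shows "subalgebra M (generated_sigma M x n)"
  unfolding subalgebra_def sets_generated_sigma
  using assms by (auto intro!: sets.sigma_sets_subset measurable_sets)

lemma subalgebra_generated_sigma_mono:
  assumes "m \<le> n"
  shows "subalgebra (generated_sigma M x n) (generated_sigma M x m)"
  unfolding subalgebra_def sets_generated_sigma
proof
  show "sigma_sets (space M) (\<Union>k\<le>m. {x k -` B \<inter> space M | B. B \<in> sets borel})
      \<subseteq> sigma_sets (space M) (\<Union>k\<le>n. {x k -` B \<inter> space M | B. B \<in> sets borel})"
    using assms by (intro sigma_sets_mono' UN_mono) auto
qed simp

locale stochastic_proximal_point = prob_space M + complete_measure M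
  for M :: "'w measure" +
  fixes A :: "'h::{real_inner,banach,second_countable_topology} \<Rightarrow> 'h set"
    and \<gamma> \<theta> :: "nat \<Rightarrow> real" and e x :: "nat \<Rightarrow> 'w \<Rightarrow> 'h" and z :: 'h
  assumes A: "maximally_monotone A" and z: "z \<in> zer A"
    and \<gamma>_pos: "\<And>n. 0 < \<gamma> n" and \<gamma>_div: "\<not> summable (\<lambda>n. (\<gamma> n)\<^sup>2)"
    and \<theta>: "\<And>n. \<theta> n = (\<Sum>k\<le>n. (\<gamma> k)\<^sup>2)"
    and e_L2: "\<And>n. e n \<in> L2_rv M" and x0_L2: "x 0 \<in> L2_rv M"
    and x_Suc: "\<And>n. AE \<omega> in M. x (Suc n) \<omega> = resolvent (scale_operator (\<gamma> n) A) (x n \<omega>) + e n \<omega>"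
begin

definition p where "p n \<omega> = resolvent (scale_operator (\<gamma> n) A) (x n \<omega>)"

definition a where "a n \<omega> = yosida (\<gamma> n) A (x n \<omega>)"

section \<open>Measurability and square integrability along the iteration\<close>

lemma \<gamma>_nonzero [simp]: "\<gamma> n \<noteq> 0"
  using \<gamma>_pos[of n] by simp

lemma \<theta>_pos: "0 < \<theta> n"
  unfolding \<theta> by (intro sum_pos) auto

lemma e_measurable [measurable]: "e n \<in> borel_measurable M"
  and e_square_integrable: "integrable M (\<lambda>\<omega>. (norm (e n \<omega>))\<^sup>2)"
  using e_L2[of n] by (auto simp: L2_rv_def)

lemma e_integrable: "integrable M (\<lambda>\<omega>. norm (e n \<omega>))"
  by (rule square_integrable_imp_integrable[OF _ e_square_integrable]) simp

lemma resolvent_measurable: "resolvent (scale_operator (\<gamma> n) A) \<in> borel_measurable borel"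
  by (intro borel_measurable_continuous_onI continuous_on_resolvent A \<gamma>_pos)

lemma x_measurable [measurable]: "x n \<in> borel_measurable M"
proof (induction n)
  case 0
  show ?case using x0_L2 by (simp add: L2_rv_def)
next
  case (Suc n)
  have "(\<lambda>\<omega>. resolvent (scale_operator (\<gamma> n) A) (x n \<omega>) + e n \<omega>) \<in> borel_measurable M"
    using measurable_compose[OF Suc resolvent_measurable] by simp
  from this x_Suc show ?case by (rule measurable_AE_cong) simp
qed

lemma p_measurable [measurable]: "p n \<in> borel_measurable M"
  unfolding p_def[abs_def] by (rule measurable_compose[OF x_measurable resolvent_measurable])

lemma a_measurable [measurable]: "a n \<in> borel_measurable M"
proof -
  have "a n = (\<lambda>\<omega>. (x n \<omega> - p n \<omega>) /\<^sub>R \<gamma> n)" by (simp add: a_def p_def yosida_def fun_eq_iff)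
  then show ?thesis by simp
qed

lemma fejer: "(norm (p n \<omega> - z))\<^sup>2 + (\<gamma> n)\<^sup>2 * (norm (a n \<omega>))\<^sup>2 \<le> (norm (x n \<omega> - z))\<^sup>2"
  unfolding p_def a_def by (rule resolvent_fejer[OF A \<gamma>_pos z])

lemma norm_x_Suc_le: "AE \<omega> in M. norm (x (Suc n) \<omega> - z) \<le> norm (p n \<omega> - z) + norm (e n \<omega>)"
  using x_Suc[of n]
proof eventually_elim
  case (elim \<omega>)
  then have "x (Suc n) \<omega> - z = (p n \<omega> - z) + e n \<omega>" by (simp add: p_def)
  then show ?case by (simp only: norm_triangle_ineq)
qed

lemma p_square_integrable_of_x:
  assumes "integrable M (\<lambda>\<omega>. (norm (x n \<omega> - z))\<^sup>2)"
  shows "integrable M (\<lambda>\<omega>. (norm (p n \<omega> - z))\<^sup>2)"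
proof (rule Bochner_Integration.integrable_bound[OF assms])
  have "(norm (p n \<omega> - z))\<^sup>2 \<le> (norm (x n \<omega> - z))\<^sup>2" for \<omega>
    using fejer[of n \<omega>] zero_le_power2[of "\<gamma> n * norm (a n \<omega>)"] unfolding power_mult_distrib by linarith
  then show "AE \<omega> in M. norm ((norm (p n \<omega> - z))\<^sup>2) \<le> norm ((norm (x n \<omega> - z))\<^sup>2)" by simp
qed measurable

lemma x_square_integrable: "integrable M (\<lambda>\<omega>. (norm (x n \<omega> - z))\<^sup>2)"
proof (induction n)
  case 0
  have "integrable M (\<lambda>\<omega>. (norm (x 0 \<omega>) + norm z)\<^sup>2)"
    using x0_L2 by (intro integrable_square_add) (auto simp: L2_rv_def)
  then show ?case
  proof (rule Bochner_Integration.integrable_bound)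
    show "AE \<omega> in M. norm ((norm (x 0 \<omega> - z))\<^sup>2) \<le> norm ((norm (x 0 \<omega>) + norm z)\<^sup>2)"
      by (simp add: power_mono norm_triangle_ineq4)
  qed measurable
next
  case (Suc n)
  have "integrable M (\<lambda>\<omega>. (norm (p n \<omega> - z) + norm (e n \<omega>))\<^sup>2)"
    by (intro integrable_square_add p_square_integrable_of_x Suc e_square_integrable) measurable
  then show ?case
  proof (rule Bochner_Integration.integrable_bound)
    show "AE \<omega> in M. norm ((norm (x (Suc n) \<omega> - z))\<^sup>2) \<le> norm ((norm (p n \<omega> - z) + norm (e n \<omega>))\<^sup>2)"
      using norm_x_Suc_le by eventually_elim (simp add: power_mono)
  qed measurable
qed

lemmas p_square_integrable = p_square_integrable_of_x[OF x_square_integrable]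

lemma a_square_integrable: "integrable M (\<lambda>\<omega>. (norm (a n \<omega>))\<^sup>2)"
proof -
  have "integrable M (\<lambda>\<omega>. (\<gamma> n)\<^sup>2 * (norm (a n \<omega>))\<^sup>2)"
  proof (rule Bochner_Integration.integrable_bound[OF x_square_integrable[of n]])
    have "(\<gamma> n)\<^sup>2 * (norm (a n \<omega>))\<^sup>2 \<le> (norm (x n \<omega> - z))\<^sup>2" for \<omega>
      using fejer[of n \<omega>] zero_le_power2[of "norm (p n \<omega> - z)"] by linarith
    then show "AE \<omega> in M. norm ((\<gamma> n)\<^sup>2 * (norm (a n \<omega>))\<^sup>2) \<le> norm ((norm (x n \<omega> - z))\<^sup>2)"
      by simp
  qed measurable
  then show ?thesis by simp
qed

text \<open>Countably many exceptional null sets are merged, and \<open>proximal_point_rate\<close>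
  is applied to each remaining path.\<close>

lemma AE_rate:
  assumes "AE \<omega> in M. summable (\<lambda>n. norm (e n \<omega>))"
    and "AE \<omega> in M. summable (\<lambda>n. \<theta> n / (\<gamma> (Suc n))\<^sup>2 * (norm (e n \<omega>))\<^sup>2)"
  shows "AE \<omega> in M. (\<lambda>n. norm (yosida (\<gamma> n) A (x n \<omega>)) * sqrt (\<theta> n)) \<longlonglongrightarrow> 0"
proof -
  have "AE \<omega> in M. \<forall>n. x (Suc n) \<omega> = resolvent (scale_operator (\<gamma> n) A) (x n \<omega>) + e n \<omega>"
    unfolding AE_all_countable using x_Suc by blast
  with assms show ?thesis
  proof eventually_elim
    case (elim \<omega>)
    show ?case
      by (rule proximal_point_rate[where x = "\<lambda>n. x n \<omega>" and e = "\<lambda>n. e n \<omega>", OF A z \<gamma>_pos \<gamma>_div \<theta>])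
        (use elim in auto)
  qed
qed

text \<open>The two deterministic lemmas are applied to root mean square distances and to the second
  moments of the Yosida values; Minkowski's inequality supplies the perturbed step. First moments
  are finally dominated by root second moments.\<close>

lemma expectation_rate:
  assumes sum: "summable (\<lambda>n. sqrt (\<integral>\<omega>. (norm (e n \<omega>))\<^sup>2 \<partial>M))"
    and wsum: "summable (\<lambda>n. \<theta> n / (\<gamma> (Suc n))\<^sup>2 * (\<integral>\<omega>. (norm (e n \<omega>))\<^sup>2 \<partial>M))"
  shows "(\<lambda>n. (\<integral>\<omega>. norm (yosida (\<gamma> n) A (x n \<omega>)) \<partial>M) * sqrt (\<theta> n)) \<longlonglongrightarrow> 0"
proof -
  define r where "r = (\<lambda>n. sqrt (\<integral>\<omega>. (norm (x n \<omega> - z))\<^sup>2 \<partial>M))"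
  define q where "q = (\<lambda>n. sqrt (\<integral>\<omega>. (norm (p n \<omega> - z))\<^sup>2 \<partial>M))"
  define b where "b = (\<lambda>n. \<integral>\<omega>. (norm (a n \<omega>))\<^sup>2 \<partial>M)"
  have b_nonneg: "0 \<le> b n" for n by (simp add: b_def)
  have "summable (\<lambda>n. (\<gamma> n)\<^sup>2 * b n)"
  proof (rule summable_decrease_of_perturbed_fejer[where r = r and q = q, OF _ _ _ _ _ _ sum])
    fix n
    have "(\<integral>\<omega>. (norm (p n \<omega> - z))\<^sup>2 + (\<gamma> n)\<^sup>2 * (norm (a n \<omega>))\<^sup>2 \<partial>M) \<le> (\<integral>\<omega>. (norm (x n \<omega> - z))\<^sup>2 \<partial>M)"
      using p_square_integrable a_square_integrable
      by (intro integral_mono x_square_integrable fejer) auto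
    then show "(q n)\<^sup>2 + (\<gamma> n)\<^sup>2 * b n \<le> (r n)\<^sup>2"
      using p_square_integrable a_square_integrable by (simp add: q_def r_def b_def)
    have "r (Suc n) \<le> sqrt (\<integral>\<omega>. (norm (p n \<omega> - z) + norm (e n \<omega>))\<^sup>2 \<partial>M)"
      unfolding r_def real_sqrt_le_iff
    proof (rule integral_mono_AE)
      show "AE \<omega> in M. (norm (x (Suc n) \<omega> - z))\<^sup>2 \<le> (norm (p n \<omega> - z) + norm (e n \<omega>))\<^sup>2"
        using norm_x_Suc_le by eventually_elim (simp add: power_mono)
      show "integrable M (\<lambda>\<omega>. (norm (p n \<omega> - z) + norm (e n \<omega>))\<^sup>2)"
        by (intro integrable_square_add p_square_integrable e_square_integrable) measurable
    qed (rule x_square_integrable)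
    also have "\<dots> \<le> q n + sqrt (\<integral>\<omega>. (norm (e n \<omega>))\<^sup>2 \<partial>M)"
      unfolding q_def
      by (intro sqrt_integral_square_triangle p_square_integrable e_square_integrable) measurable
    finally show "r (Suc n) \<le> q n + sqrt (\<integral>\<omega>. (norm (e n \<omega>))\<^sup>2 \<partial>M)" .
  qed (simp_all add: r_def q_def b_def)
  moreover have "b (Suc n) \<le> b n + (\<integral>\<omega>. (norm (e n \<omega>))\<^sup>2 \<partial>M) / (\<gamma> (Suc n))\<^sup>2" for n
  proof -
    have "b (Suc n) \<le> (\<integral>\<omega>. (norm (a n \<omega>))\<^sup>2 + (norm (e n \<omega>))\<^sup>2 / (\<gamma> (Suc n))\<^sup>2 \<partial>M)"
      unfolding b_def
    proof (rule integral_mono_AE)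
      show "AE \<omega> in M. (norm (a (Suc n) \<omega>))\<^sup>2 \<le> (norm (a n \<omega>))\<^sup>2 + (norm (e n \<omega>))\<^sup>2 / (\<gamma> (Suc n))\<^sup>2"
        using x_Suc[of n]
      proof eventually_elim
        case (elim \<omega>)
        show ?case unfolding a_def elim by (rule norm_yosida_perturbed_step[OF A \<gamma>_pos \<gamma>_pos])
      qed
    qed (use a_square_integrable e_square_integrable in auto)
    then show ?thesis using a_square_integrable e_square_integrable by (simp add: b_def)
  qed
  ultimately have "(\<lambda>n. \<theta> n * b n) \<longlonglongrightarrow> 0"
    using wsum b_nonneg
    by (intro weighted_tendsto_zero[where g = "\<lambda>n. (\<gamma> n)\<^sup>2"
          and c = "\<lambda>n. (\<integral>\<omega>. (norm (e n \<omega>))\<^sup>2 \<partial>M) / (\<gamma> (Suc n))\<^sup>2", OF _ \<gamma>_div \<theta>]) simp_all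
  from tendsto_real_sqrt[OF this]
  have lim: "(\<lambda>n. sqrt (b n) * sqrt (\<theta> n)) \<longlonglongrightarrow> 0" by (simp add: real_sqrt_mult mult.commute)
  have le: "(\<integral>\<omega>. norm (a n \<omega>) \<partial>M) * sqrt (\<theta> n) \<le> sqrt (b n) * sqrt (\<theta> n)" for n
    unfolding b_def using \<theta>_pos[of n]
    by (intro mult_right_mono integral_le_sqrt_integral_square a_square_integrable) auto
  have nonneg: "0 \<le> (\<integral>\<omega>. norm (a n \<omega>) \<partial>M) * sqrt (\<theta> n)" for n
    using \<theta>_pos[of n] by simp
  have "(\<lambda>n. (\<integral>\<omega>. norm (a n \<omega>) \<partial>M) * sqrt (\<theta> n)) \<longlonglongrightarrow> 0"
    by (rule tendsto_sandwich[OF _ _ tendsto_const lim]) (simp_all add: le nonneg)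
  then show ?thesis by (simp add: a_def)
qed

lemma AE_rate_of_summable_expectations:
  assumes sum: "summable (\<lambda>n. sqrt (\<integral>\<omega>. (norm (e n \<omega>))\<^sup>2 \<partial>M))"
    and wsum: "summable (\<lambda>n. \<theta> n / (\<gamma> (Suc n))\<^sup>2 * (\<integral>\<omega>. (norm (e n \<omega>))\<^sup>2 \<partial>M))"
  shows "AE \<omega> in M. (\<lambda>n. norm (yosida (\<gamma> n) A (x n \<omega>)) * sqrt (\<theta> n)) \<longlonglongrightarrow> 0"
proof (rule AE_rate)
  have "summable (\<lambda>n. \<integral>\<omega>. norm (e n \<omega>) \<partial>M)"
  proof (rule summable_comparison_test'[OF sum])
    show "norm (\<integral>\<omega>. norm (e n \<omega>) \<partial>M) \<le> sqrt (\<integral>\<omega>. (norm (e n \<omega>))\<^sup>2 \<partial>M)" for n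
      using integral_le_sqrt_integral_square[OF _ e_square_integrable] by simp
  qed
  then show "AE \<omega> in M. summable (\<lambda>n. norm (e n \<omega>))"
    by (rule AE_summable_of_summable_integral[OF e_integrable norm_ge_zero])
  show "AE \<omega> in M. summable (\<lambda>n. \<theta> n / (\<gamma> (Suc n))\<^sup>2 * (norm (e n \<omega>))\<^sup>2)"
  proof (rule AE_summable_of_summable_integral)
    show "integrable M (\<lambda>\<omega>. \<theta> n / (\<gamma> (Suc n))\<^sup>2 * (norm (e n \<omega>))\<^sup>2)" for n
      by (intro integrable_mult_right e_square_integrable)
    show "summable (\<lambda>n. \<integral>\<omega>. \<theta> n / (\<gamma> (Suc n))\<^sup>2 * (norm (e n \<omega>))\<^sup>2 \<partial>M)"
      using wsum by (simp only: integral_mult_right_zero)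
    show "0 \<le> \<theta> n / (\<gamma> (Suc n))\<^sup>2 * (norm (e n \<omega>))\<^sup>2" for n \<omega>
      using \<theta>_pos[of n] by simp
  qed
qed

lemma AE_rate_of_summable_cond_exps:
  defines "V \<equiv> \<lambda>n. real_cond_exp M (generated_sigma M x n) (\<lambda>\<omega>. (norm (e n \<omega>))\<^sup>2)"
  assumes sum: "AE \<omega> in M. summable (\<lambda>n. sqrt (V n \<omega>))"
    and wsum: "AE \<omega> in M. summable (\<lambda>n. \<theta> n / (\<gamma> (Suc n))\<^sup>2 * V n \<omega>)"
  shows "AE \<omega> in M. (\<lambda>n. norm (yosida (\<gamma> n) A (x n \<omega>)) * sqrt (\<theta> n)) \<longlonglongrightarrow> 0"
proof (rule AE_rate)
  note sub = subalgebra_generated_sigma[of x M, OF x_measurable]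
  interpret F: sigma_finite_subalgebra M "generated_sigma M x n" for n
    by (intro finite_measure_subalgebra_is_sigma_finite)
      (simp add: finite_measure_subalgebra_def finite_measure_subalgebra_axioms_def finite_measure_axioms sub)
  \<comment> \<open>Conditional Jensen bounds the conditional mean of the error norm by the square
    root of \<open>V n\<close>, so the first hypothesis makes these means summable.\<close>
  have "AE \<omega> in M. \<forall>n. (real_cond_exp M (generated_sigma M x n) (\<lambda>\<omega>. norm (e n \<omega>)) \<omega>)\<^sup>2 \<le> V n \<omega>"
    unfolding AE_all_countable V_def
    by (intro allI F.real_cond_exp_jensens_inequality(2)[where I = UNIV])
      (simp_all add: e_integrable e_square_integrable convex_power2)
  moreover have "AE \<omega> in M. \<forall>n. 0 \<le> real_cond_exp M (generated_sigma M x n) (\<lambda>\<omega>. norm (e n \<omega>)) \<omega>"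
    unfolding AE_all_countable by (intro allI F.real_cond_exp_pos) simp_all
  ultimately have sum': "AE \<omega> in M. summable (\<lambda>n. real_cond_exp M (generated_sigma M x n) (\<lambda>\<omega>. norm (e n \<omega>)) \<omega>)"
    using sum
  proof eventually_elim
    case (elim \<omega>)
    show ?case
      by (rule summable_comparison_test'[OF elim(3)]) (use elim in \<open>simp add: real_le_rsqrt\<close>)
  qed
  show "AE \<omega> in M. summable (\<lambda>n. norm (e n \<omega>))"
    by (rule AE_summable_of_summable_cond_exp[OF sub subalgebra_generated_sigma_mono
          e_integrable norm_ge_zero sum'])
  \<comment> \<open>The deterministic weight moves inside the conditional expectation, so that the
    summability criterion applies to the weighted squares.\<close>
  have "AE \<omega> in M. \<forall>n. real_cond_exp M (generated_sigma M x n)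
      (\<lambda>\<omega>. \<theta> n / (\<gamma> (Suc n))\<^sup>2 * (norm (e n \<omega>))\<^sup>2) \<omega> = \<theta> n / (\<gamma> (Suc n))\<^sup>2 * V n \<omega>"
    unfolding AE_all_countable V_def by (intro allI F.real_cond_exp_cmult e_square_integrable)
  with wsum have wsum': "AE \<omega> in M. summable (\<lambda>n. real_cond_exp M (generated_sigma M x n)
      (\<lambda>\<omega>. \<theta> n / (\<gamma> (Suc n))\<^sup>2 * (norm (e n \<omega>))\<^sup>2) \<omega>)"
    by eventually_elim (simp only:)
  show "AE \<omega> in M. summable (\<lambda>n. \<theta> n / (\<gamma> (Suc n))\<^sup>2 * (norm (e n \<omega>))\<^sup>2)"
  proof (rule AE_summable_of_summable_cond_exp[OF sub subalgebra_generated_sigma_mono _ _ wsum'])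
    show "integrable M (\<lambda>\<omega>. \<theta> n / (\<gamma> (Suc n))\<^sup>2 * (norm (e n \<omega>))\<^sup>2)" for n
      by (intro integrable_mult_right e_square_integrable)
    show "0 \<le> \<theta> n / (\<gamma> (Suc n))\<^sup>2 * (norm (e n \<omega>))\<^sup>2" for n \<omega>
      using \<theta>_pos[of n] by simp
  qed
qed

text \<open>As \<open>\<theta>\<close> is nondecreasing, pairing the norm at \<open>Suc n\<close>
  with \<open>\<theta> n\<close> only shrinks the product. This yields the indexing of (i).\<close>

lemma rate_shift:
  assumes "(\<lambda>n. norm (f n) * sqrt (\<theta> n)) \<longlonglongrightarrow> 0"
  shows "(\<lambda>n. norm (f (Suc n)) * sqrt (\<theta> n)) \<longlonglongrightarrow> 0"
proof (rule tendsto_sandwich[OF _ _ tendsto_const LIMSEQ_Suc[OF assms]])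
  have "\<theta> n \<le> \<theta> (Suc n)" for n by (simp add: \<theta>)
  then show "\<forall>\<^sub>F n in sequentially.
      norm (f (Suc n)) * sqrt (\<theta> n) \<le> norm (f (Suc n)) * sqrt (\<theta> (Suc n))"
    by (simp add: mult_left_mono)
  show "\<forall>\<^sub>F n in sequentially. 0 \<le> norm (f (Suc n)) * sqrt (\<theta> n)"
    using \<theta>_pos by (simp add: less_imp_le)
qed

end

theorem theorem3p1:
  fixes M :: "'w measure"
    and A :: "'h::{real_inner, banach, second_countable_topology} \<Rightarrow> 'h set"
    and \<gamma> \<theta> :: "nat \<Rightarrow> real"
    and e x :: "nat \<Rightarrow> 'w \<Rightarrow> 'h"
    and \<F> :: "nat \<Rightarrow> 'w measure"
  assumes "prob_space M" and "complete_measure M"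
    and "maximally_monotone A" and "zer A \<noteq> {}"
    and "\<And>n. \<gamma> n > 0" and "\<not> summable (\<lambda>n. (\<gamma> n)\<^sup>2)"
    and "\<And>n. e n \<in> L2_rv M" and "x 0 \<in> L2_rv M"
    and "\<And>n. AE \<omega> in M. x (Suc n) \<omega> = resolvent (scale_operator (\<gamma> n) A) (x n \<omega>) + e n \<omega>"
    and "\<And>n. \<F> n = generated_sigma M x n"
    and "\<And>n. \<theta> n = (\<Sum>k\<le>n. (\<gamma> k)\<^sup>2)"
  shows
    "((AE \<omega> in M. summable (\<lambda>n. sqrt (real_cond_exp M (\<F> n) (\<lambda>\<omega>'. (norm (e n \<omega>'))\<^sup>2) \<omega>))) \<and>
      (AE \<omega> in M. summable (\<lambda>n. \<theta> n / (\<gamma> (Suc n))\<^sup>2 *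
                                real_cond_exp M (\<F> n) (\<lambda>\<omega>'. (norm (e n \<omega>'))\<^sup>2) \<omega>)) \<longrightarrow>
      (AE \<omega> in M. (\<lambda>n. norm (yosida (\<gamma> (Suc n)) A (x (Suc n) \<omega>)) * sqrt (\<theta> n)) \<longlonglongrightarrow> 0))
   \<and> (summable (\<lambda>n. sqrt (\<integral>\<omega>. (norm (e n \<omega>))\<^sup>2 \<partial>M)) \<and>
      summable (\<lambda>n. \<theta> n / (\<gamma> (Suc n))\<^sup>2 * (\<integral>\<omega>. (norm (e n \<omega>))\<^sup>2 \<partial>M)) \<longrightarrow>
      (AE \<omega> in M. (\<lambda>n. norm (yosida (\<gamma> n) A (x n \<omega>)) * sqrt (\<theta> n)) \<longlonglongrightarrow> 0) \<and>
      (\<lambda>n. (\<integral>\<omega>. norm (yosida (\<gamma> n) A (x n \<omega>)) \<partial>M) * sqrt (\<theta> n)) \<longlonglongrightarrow> 0)"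
proof -
  obtain z where "z \<in> zer A" using assms(4) by blast
  then interpret stochastic_proximal_point M A \<gamma> \<theta> e x z
    using assms
    by (simp add: stochastic_proximal_point_def stochastic_proximal_point_axioms_def)
  show ?thesis
    unfolding assms(10)
  proof (intro conjI impI; elim conjE)
    assume "AE \<omega> in M. summable (\<lambda>n. sqrt (real_cond_exp M (generated_sigma M x n) (\<lambda>\<omega>'. (norm (e n \<omega>'))\<^sup>2) \<omega>))"
      and "AE \<omega> in M. summable (\<lambda>n. \<theta> n / (\<gamma> (Suc n))\<^sup>2 *
        real_cond_exp M (generated_sigma M x n) (\<lambda>\<omega>'. (norm (e n \<omega>'))\<^sup>2) \<omega>)"
    from AE_rate_of_summable_cond_exps[OF this]
    show "AE \<omega> in M. (\<lambda>n. norm (yosida (\<gamma> (Suc n)) A (x (Suc n) \<omega>)) * sqrt (\<theta> n)) \<longlonglongrightarrow> 0"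
      by eventually_elim (rule rate_shift)
  qed (fact AE_rate_of_summable_expectations expectation_rate)+
qed

end
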